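(* Fix a diagram $D\subseteq[n]\times[n]$ and $k,l\in[n]$, and let $\widehat{D}$ be the diagram obtained from $D$ by removing all boxes in row $k$ or column $l$. If there is a diagram $K\in\mathrm{Purple}_{k,l}(D)$ such that $M(x_1,\dots,x_n)=\prod_{(i,j)\in K}x_i$, then \[ \chi_D(x_1,\dots,x_n) - M(x_1,\dots,x_n)\,\chi_{\widehat D}(x_1,\dots,x_{k-1},0,x_{k+1},\dots,x_n)\in\mathbb{Z}_{\ge0}[x_1,\dots,x_n]. \]
   Context: A diagram is a subset of $[n]\times[n]$ (box $(i,j)$ in row $i$, column $j$), equivalently a column sequence $(D_1,\dots,D_n)$, $D_j=\{i:(i,j)\in D\}$. For $R,S\subseteq[n]$, $R\le S$ means $\#R=\#S$ and the $t$-th smallest element of $R$ is at most the $t$-th smallest of $S$ for all $t$; $C\le D$ means $C_j\le D_j$ for all $j$. For a diagram $C$, $\widehat{C}_{k,l}$ is $C$ with all boxes in row $k$ or column $l$ removed. $\mathrm{purple}_{k,l}(D)$ is the set of boxes $(i,j)$ such that some $C\le D$ contains $(i,j)$, but no $C\le D$ with $\widehat{C}_{k,l}\le\widehat{D}_{k,l}$ has $(i,j)\in\widehat{C}_{k,l}$. $\mathrm{Purple}_{k,l}(D)$ is the smallest set of diagrams containing $D\setminus\widehat{D}_{k,l}$ and such that if $K\in\mathrm{Purple}_{k,l}(D)$, $K'\le K$ and $K'\subseteq\mathrm{purple}_{k,l}(D)$ then $K'\in\mathrm{Purple}_{k,l}(D)$. Dual characters: let $Y$ be the $n\times n$ upper-triangular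 matrix with indeterminates $y_{ij}$ ($i\le j$) and zeros below the diagonal; for $R,S\subseteq[n]$, $Y^R_S$ is the submatrix with rows $R$ and columns $S$. The Borel group $B$ of invertible upper-triangular complex matrices acts on $\mathbb{C}[y_{ij}]$ by $(f\cdot b)(Y)=f(b^{-1}Y)$. The flagged Weyl module is $\mathcal{M}_D=\mathrm{Span}_{\mathbb C}\{\prod_{j=1}^n\det(Y^{C_j}_{D_j}) : C\le D\}$, a $B$-module, and $\chi_D(x_1,\dots,x_n)$ is the trace of $\mathrm{diag}(x_1,\dots,x_n)$ acting on $\mathcal{M}_D$, with each $x_i$ replaced by $x_i^{-1}$ (the character of the dual module). *)

theory Defs
  imports
    "HOL-Library.Poly_Mapping"
    "Jordan_Normal_Form.Determinant"
    "Jordan_Normal_Form.Gauss_Jordan_Elimination"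
    "Jordan_Normal_Form.DL_Submatrix"
begin

section \<open>Diagrams\<close>

text \<open>
  Rows, columns and variables are numbered from 0, in agreement with the matrix library, so that
  \<^term>\<open>{..<n}\<close> plays the role of the set of the first n positive integers.  The box
  \<^term>\<open>(i, j)\<close> lies in row i and column j.
\<close>

type_synonym diagram = "(nat \<times> nat) set"

definition diagrams :: "nat \<Rightarrow> diagram set" where
  "diagrams n = Pow ({..<n} \<times> {..<n})"

definition column :: "diagram \<Rightarrow> nat \<Rightarrow> nat set" where
  "column D j = {i. (i, j) \<in> D}"

definition set_le :: "nat set \<Rightarrow> nat set \<Rightarrow> bool" where
  "set_le R S \<longleftrightarrow> card R = card S \<and>
     (\<forall>t < card R. sorted_list_of_set R ! t \<le> sorted_list_of_set S ! t)"

definition diagram_le :: "nat \<Rightarrow> diagram \<Rightarrow> diagram \<Rightarrow> bool" where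
  "diagram_le n C D \<longleftrightarrow> C \<in> diagrams n \<and> D \<in> diagrams n \<and>
     (\<forall>j<n. set_le (column C j) (column D j))"

definition hat :: "nat \<Rightarrow> nat \<Rightarrow> diagram \<Rightarrow> diagram" where
  "hat k l C = {(i, j) \<in> C. i \<noteq> k \<and> j \<noteq> l}"

definition purple :: "nat \<Rightarrow> nat \<Rightarrow> nat \<Rightarrow> diagram \<Rightarrow> (nat \<times> nat) set" where
  "purple n k l D = {(i, j).
     (\<exists>C. diagram_le n C D \<and> (i, j) \<in> C) \<and>
     \<not> (\<exists>C. diagram_le n C D \<and> diagram_le n (hat k l C) (hat k l D) \<and> (i, j) \<in> hat k l C)}"

inductive_set Purple :: "nat \<Rightarrow> nat \<Rightarrow> nat \<Rightarrow> diagram \<Rightarrow> diagram set"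
  for n k l :: nat and D :: diagram where
  base: "D - hat k l D \<in> Purple n k l D"
| step: "K \<in> Purple n k l D \<Longrightarrow> diagram_le n K' K \<Longrightarrow> K' \<subseteq> purple n k l D \<Longrightarrow>
     K' \<in> Purple n k l D"

section \<open>Multivariate polynomials\<close>

text \<open>Finitely supported functions on monomials, with the convolution product.\<close>

type_synonym ('v, 'a) mpoly = "('v \<Rightarrow>\<^sub>0 nat) \<Rightarrow>\<^sub>0 'a"

definition Const :: "'a::zero \<Rightarrow> ('v, 'a) mpoly" where
  "Const c = Poly_Mapping.single 0 c"

definition Var :: "'v \<Rightarrow> ('v, 'a::zero_neq_one) mpoly" where
  "Var v = Poly_Mapping.single (Poly_Mapping.single v 1) 1"

text \<open>
  \<^term>\<open>eval_with h \<sigma> p\<close> applies \<^term>\<open>h\<close> to the coefficients and replaces each variable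
  \<^term>\<open>v\<close> by \<^term>\<open>\<sigma> v\<close>.
\<close>

definition eval_with :: "('a::zero \<Rightarrow> 'b::comm_semiring_1) \<Rightarrow> ('v \<Rightarrow> 'b) \<Rightarrow> ('v, 'a) mpoly \<Rightarrow> 'b" where
  "eval_with h \<sigma> p = (\<Sum>m\<in>Poly_Mapping.keys p.
     h (Poly_Mapping.lookup p m) *
     (\<Prod>v\<in>Poly_Mapping.keys m. \<sigma> v ^ Poly_Mapping.lookup m v))"

definition eval_poly :: "('v \<Rightarrow> 'a::comm_semiring_1) \<Rightarrow> ('v, 'a) mpoly \<Rightarrow> 'a" where
  "eval_poly x = eval_with (\<lambda>c. c) x"

definition subst_poly ::
    "('v \<Rightarrow> ('w, 'a::comm_semiring_1) mpoly) \<Rightarrow> ('v, 'a) mpoly \<Rightarrow> ('w, 'a) mpoly" where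
  "subst_poly \<sigma> = eval_with Const \<sigma>"

definition vars :: "('v, 'a::zero) mpoly \<Rightarrow> 'v set" where
  "vars p = (\<Union>m\<in>Poly_Mapping.keys p. Poly_Mapping.keys m)"

text \<open>
  The polynomials in the variables 0, ..., n - 1 with nonnegative integer coefficients, as a subset
  of the complex polynomials (\<^term>\<open>\<nat> :: complex set\<close> is the image of the natural numbers).
\<close>

definition nonneg_int_polys :: "nat \<Rightarrow> (nat, complex) mpoly set" where
  "nonneg_int_polys n = {p. vars p \<subseteq> {..<n} \<and> (\<forall>m. Poly_Mapping.lookup p m \<in> \<nat>)}"

definition scale_poly :: "complex \<Rightarrow> ('v, complex) mpoly \<Rightarrow> ('v, complex) mpoly" where
  "scale_poly c p = Const c * p"

global_interpretation mpoly: vector_space "scale_poly :: complex \<Rightarrow> ('v, complex) mpoly \<Rightarrow> _"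
proof
  fix a b :: complex and x y :: "('v, complex) mpoly"
  show "scale_poly a (x + y) = scale_poly a x + scale_poly a y"
    by (simp add: scale_poly_def algebra_simps)
  show "scale_poly (a + b) x = scale_poly a x + scale_poly b x"
    by (simp add: scale_poly_def Const_def single_add algebra_simps)
  show "scale_poly a (scale_poly b x) = scale_poly (a * b) x"
    by (simp add: scale_poly_def Const_def mult_single flip: mult.assoc)
  show "scale_poly 1 x = x"
    by (simp add: scale_poly_def Const_def)
qed

text \<open>
  Trace of a linear operator preserving a finite-dimensional subspace \<^term>\<open>V\<close>; it does not
  depend on the basis chosen.
\<close>

definition trace_on ::
    "('v, complex) mpoly set \<Rightarrow> (('v, complex) mpoly \<Rightarrow> ('v, complex) mpoly) \<Rightarrow> complex" where
  "trace_on V T = (let B = (SOME B. mpoly.independent B \<and> mpoly.span B = V)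
     in \<Sum>b\<in>B. mpoly.representation B (T b) b)"

section \<open>Flagged Weyl modules and dual characters\<close>

definition Ymat :: "nat \<Rightarrow> (nat \<times> nat, complex) mpoly mat" where
  "Ymat n = mat n n (\<lambda>(i, j). if i \<le> j then Var (i, j) else 0)"

definition borel :: "nat \<Rightarrow> complex mat set" where
  "borel n = {b \<in> carrier_mat n n. upper_triangular b \<and> invertible_mat b}"

text \<open>
  The action of \<^term>\<open>b \<in> borel n\<close>, \<open>(f . b)(Y) = f(b^-1 Y)\<close>.  It is meant for polynomials in
  the variables \<^term>\<open>Var (i, j)\<close> with \<open>i \<le> j < n\<close>; the values at other variables are irrelevant.
\<close>

definition borel_act ::
    "nat \<Rightarrow> complex mat \<Rightarrow> (nat \<times> nat, complex) mpoly \<Rightarrow> (nat \<times> nat, complex) mpoly" where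
  "borel_act n b f =
     subst_poly (\<lambda>ij. (map_mat Const (the (mat_inverse b)) * Ymat n) $$ ij) f"

definition weyl_module :: "nat \<Rightarrow> diagram \<Rightarrow> (nat \<times> nat, complex) mpoly set" where
  "weyl_module n D = mpoly.span
     {\<Prod>j<n. det (submatrix (Ymat n) (column C j) (column D j)) | C. diagram_le n C D}"

definition weyl_character :: "nat \<Rightarrow> diagram \<Rightarrow> (nat \<Rightarrow> complex) \<Rightarrow> complex" where
  "weyl_character n D x = trace_on (weyl_module n D) (borel_act n (mat_diag n x))"

text \<open>
  The dual character as a polynomial: the unique polynomial in the variables 0, ..., n - 1 that
  agrees on the whole torus with the character at the inverted arguments.
\<close>

definition dual_character :: "nat \<Rightarrow> diagram \<Rightarrow> (nat, complex) mpoly" where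
  "dual_character n D = (THE p. vars p \<subseteq> {..<n} \<and>
     (\<forall>x. (\<forall>i<n. x i \<noteq> 0) \<longrightarrow>
        eval_poly x p = weyl_character n D (\<lambda>i. inverse (x i))))"

definition set_var_zero :: "nat \<Rightarrow> (nat, complex) mpoly \<Rightarrow> (nat, complex) mpoly" where
  "set_var_zero k = subst_poly (\<lambda>i. if i = k then 0 else Var i)"

end

(*
  The dual character is the sum of the monomials x^C over any set of diagrams C whose products of
  minors form a basis of the Weyl module, because these products are weight vectors.  Take such a
  basis for the diagram hat D and keep the diagrams C without a box in row k.  The diagrams
  C Un K lie below D and their products of minors are again linearly independent: up to a fixed
  nonzero factor from column l, the part of top degree in the variables of column k, where y_rk has
  degree r, is a scalar multiple of the product of minors for C.  Here K in Purple is used: a box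
  of K in a column j other than l lies in row k, or it is below all boxes of column j of hat D.
  Extending to a basis of the Weyl module of D, the difference is the sum of the monomials of the
  additional basis elements.
*)
theory Submission
  imports Defs "HOL-Library.Product_Lexorder"
begin

text \<open>The lexicographic order is imported because
  \<^typ>\<open>(nat \<times> nat, complex) mpoly\<close> is an integral domain only by
  an instance requiring ordered variables.\<close>

section \<open>Comparison of sets\<close>

text \<open>Products of minors for different diagrams may be linearly dependent, so sums over all
  diagrams below \<open>D\<close> and \<open>hat k l D\<close> cannot be compared directly;
  independence itself has to be carried over. A single linear procedure, the same for every C, does
  this: cancel the minor of column l, grade by column k of \<open>Ymat\<close>, and read the
  coefficient at one degree fixed by \<open>K\<close>. Row k of \<open>D\<close> turns into column k
  of \<open>Ymat\<close>, because the columns of \<open>D\<close> select columns of the matrix. In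
  the Laplace expansion along it, row i contributes y_ik, which is zero for i > k. Giving y_ik
  degree i lets the largest row i <= k win. The purple condition makes this the row of
  \<open>K\<close>, so striking it from the union of C and \<open>K\<close> gives back C. Putting
  x_k = 0 discards exactly the diagrams with a box in row k. This is what keeps C and
  \<open>K\<close> apart when the box of \<open>K\<close> in a column sits in row k.\<close>

lemma pick_less_iff:
  assumes "finite S" "t < card S"
  shows "pick S t < m \<longleftrightarrow> t < card {a \<in> S. a < m}"
proof
  assume "pick S t < m"
  moreover have "pick S t \<in> S" using assms pick_in_set by blast
  ultimately have "{a \<in> S. a < pick S t} \<subset> {a \<in> S. a < m}" by auto
  then have "card {a \<in> S. a < pick S t} < card {a \<in> S. a < m}"
    using assms by (intro psubset_card_mono) auto
  then show "t < card {a \<in> S. a < m}" using assms card_pick by simp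
next
  assume *: "t < card {a \<in> S. a < m}"
  show "pick S t < m"
  proof (rule ccontr)
    assume "\<not> pick S t < m"
    then have "card {a \<in> S. a < m} \<le> t" using assms card_le_pick by simp
    with * show False by simp
  qed
qed

text \<open>\<open>set_le\<close> compares sorted lists, whereas \<open>submatrix\<close> selects
  rows and columns by \<open>pick\<close>. Both enumerations are pinned down by the number of
  smaller elements.\<close>

lemma sorted_list_of_set_nth_eq_pick:
  assumes "finite S" "t < card S"
  shows "sorted_list_of_set S ! t = pick S t"
proof -
  let ?xs = "sorted_list_of_set S"
  have len: "length ?xs = card S" and set: "set ?xs = S"
    using assms by auto
  have mono: "?xs ! i < ?xs ! j \<longleftrightarrow> i < j" if "i < card S" "j < card S" for i j
  proof -
    have less: "?xs ! a < ?xs ! b" if "a < b" "b < card S" for a b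
      using that len by (simp add: sorted_wrt_nth_less)
    show ?thesis
      using less[of i j] less[of j i] that by (cases i j rule: linorder_cases) auto
  qed
  have "{a \<in> S. a < ?xs ! t} = (!) ?xs ` {..<t}"
  proof (intro equalityI subsetI)
    fix a assume "a \<in> {a \<in> S. a < ?xs ! t}"
    then obtain i where "i < card S" "a = ?xs ! i" "?xs ! i < ?xs ! t"
      using set len by (metis (no_types, lifting) in_set_conv_nth mem_Collect_eq)
    then show "a \<in> (!) ?xs ` {..<t}" using mono assms by auto
  next
    fix a assume "a \<in> (!) ?xs ` {..<t}"
    then obtain i where "i < t" "a = ?xs ! i" by auto
    moreover from \<open>i < t\<close> have "?xs ! i \<in> S"
      using nth_mem[of i ?xs] set len assms(2) by simp
    ultimately show "a \<in> {a \<in> S. a < ?xs ! t}" using mono assms(2) by auto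
  qed
  moreover have "inj_on ((!) ?xs) {..<t}"
    using len assms(2) by (intro inj_on_nth) auto
  ultimately have "card {a \<in> S. a < ?xs ! t} = t"
    by (simp add: card_image)
  moreover have "?xs ! t \<in> S" 
    using nth_mem[of t ?xs] set len assms(2) by simp
  ultimately show ?thesis using pick_card_in_set[of "?xs ! t" S] by simp
qed

lemma set_le_iff_pick:
  assumes "finite R" "finite S"
  shows "set_le R S \<longleftrightarrow> card R = card S \<and> (\<forall>t < card R. pick R t \<le> pick S t)"
  using assms by (auto simp: set_le_def sorted_list_of_set_nth_eq_pick)

text \<open>Counting below a threshold avoids indices: inserting an element raises some counts by
  one, while it shifts all later positions of an enumeration.\<close>

lemma set_le_iff_count:
  assumes "finite R" "finite S"
  shows "set_le R S \<longleftrightarrow>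
    card R = card S \<and> (\<forall>m. card {a \<in> S. a < m} \<le> card {a \<in> R. a < m})"
proof -
  have "(\<forall>t < card R. pick R t \<le> pick S t) \<longleftrightarrow>
      (\<forall>m. card {a \<in> S. a < m} \<le> card {a \<in> R. a < m})" if card: "card R = card S"
  proof (intro iffI allI impI)
    fix m assume le: "\<forall>t < card R. pick R t \<le> pick S t"
    show "card {a \<in> S. a < m} \<le> card {a \<in> R. a < m}"
    proof (rule ccontr)
      let ?t = "card {a \<in> R. a < m}"
      assume "\<not> ?thesis"
      then have t: "?t < card {a \<in> S. a < m}" by simp
      also have "\<dots> \<le> card S" using assms by (intro card_mono) auto
      finally have "?t < card S" .
      then have "pick R ?t < m" using t le card pick_less_iff[OF assms(2)]
        by (metis le_less_trans)
      then show False using \<open>?t < card S\<close> card pick_less_iff[OF assms(1)] by simp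
    qed
  next
    fix t assume *: "\<forall>m. card {a \<in> S. a < m} \<le> card {a \<in> R. a < m}" and t: "t < card R"
    \<comment> \<open>\<open>Suc (pick S t)\<close> is the least threshold below which
      \<open>S\<close> has t + 1 elements.\<close>
    have "t < card {a \<in> S. a < Suc (pick S t)}"
      using pick_less_iff[OF assms(2), of t "Suc (pick S t)"] t card by simp
    then have "pick R t < Suc (pick S t)"
      using * t pick_less_iff[OF assms(1)] by (metis less_le_trans)
    then show "pick R t \<le> pick S t" by simp
  qed
  then show ?thesis using set_le_iff_pick[OF assms] by auto
qed

lemma set_le_trans:
  assumes "set_le A B" "set_le B C"
  shows "set_le A C"
  using assms unfolding set_le_def by (metis order_trans)

lemma set_le_refl [simp]: "set_le A A"
  by (simp add: set_le_def)

lemma card_insert_less: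
  assumes "finite A" "x \<notin> A"
  shows "card {a \<in> insert x A. a < m} = card {a \<in> A. a < m} + (if x < m then 1 else (0::nat))"
proof -
  have "{a \<in> insert x A. a < m} = (if x < m then insert x {a \<in> A. a < m} else {a \<in> A. a < m})"
    by auto
  then show ?thesis using assms by simp
qed

text \<open>Where the count for \<open>B\<close> rises, y lies below the threshold, hence so does x,
  and the count for \<open>A\<close> rises too.\<close>

lemma set_le_insert:
  assumes "finite A" "finite B" "x \<notin> A" "y \<notin> B" "set_le A B" "x \<le> y"
  shows "set_le (insert x A) (insert y B)"
proof -
  have "card {a \<in> B. a < m} \<le> card {a \<in> A. a < m}" for m
    using assms by (simp add: set_le_iff_count)
  then show ?thesis
    using assms card_insert_less[OF assms(1,3)] card_insert_less[OF assms(2,4)]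
    by (auto simp del: insert_iff simp: set_le_iff_count le_SucI)
qed

lemma set_le_bound:
  assumes "finite A" "finite B" "set_le A B" "\<forall>b \<in> B. b < m" "a \<in> A"
  shows "a < m"
proof -
  have "{b \<in> B. b < m} = B" using assms by auto
  then have "card A \<le> card {a \<in> A. a < m}"
    using assms(3) set_le_iff_count[OF assms(1,2)] by (metis (lifting))
  then have "{a \<in> A. a < m} = A"
    using assms(1) by (intro card_seteq) auto
  then show ?thesis using assms by auto
qed

lemma set_le_empty_iff:
  assumes "finite R"
  shows "set_le R {} \<longleftrightarrow> R = {}"
  using assms by (auto simp: set_le_def)

lemma set_le_singletonD:
  assumes "set_le R {k}"
  obtains r where "R = {r}" "r \<le> k"
  using assms by (auto simp: set_le_def card_1_singleton_iff)

lemma bij_betw_pick: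
  assumes "finite S"
  shows "bij_betw (pick S) {..<card S} S"
proof -
  have "inj_on (pick S) {..<card S}"
    using card_pick by (intro inj_onI) (metis lessThan_iff)
  moreover have "pick S ` {..<card S} \<subseteq> S" using pick_in_set by auto
  ultimately show ?thesis using assms
    by (simp add: bij_betw_def card_image card_subset_eq)
qed

text \<open>The index skip agrees with that of \<open>mat_delete\<close>; this makes the minors in a
  Laplace expansion submatrices of \<open>Ymat\<close> again.\<close>

lemma pick_Diff:
  assumes "finite S" "i < card S" "t < card S - 1"
  shows "pick (S - {pick S i}) t = pick S (if t < i then t else Suc t)"
proof -
  let ?t' = "if t < i then t else Suc t"
  have t': "?t' < card S" "?t' \<noteq> i" using assms by auto
  then have mem: "pick S ?t' \<in> S" "pick S i \<in> S" using pick_in_set assms by auto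
  have less: "pick S i < pick S ?t' \<longleftrightarrow> i < ?t'" and ne: "pick S i \<noteq> pick S ?t'"
    using pick_mono[of ?t' S i] pick_mono[of i S ?t'] t' assms(2)
    by (cases i ?t' rule: linorder_cases; force)+
  have "{a \<in> S - {pick S i}. a < pick S ?t'} = {a \<in> S. a < pick S ?t'} - {pick S i}"
    by auto
  then have "card {a \<in> S - {pick S i}. a < pick S ?t'} = ?t' - (if i < ?t' then 1 else 0)"
    using less ne mem t'(1) card_pick[of ?t' S] by (auto simp: card_Diff_singleton_if)
  also have "\<dots> = t" by auto
  finally show ?thesis using mem ne pick_card_in_set[of "pick S ?t'" "S - {pick S i}"] by simp
qed

section \<open>Evaluation of polynomials\<close>

definition monom_eval :: "('v \<Rightarrow> 'b::comm_semiring_1) \<Rightarrow> ('v \<Rightarrow>\<^sub>0 nat) \<Rightarrow> 'b" where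
  "monom_eval \<sigma> m = (\<Prod>v\<in>Poly_Mapping.keys m. \<sigma> v ^ Poly_Mapping.lookup m v)"

lemma monom_eval_superset:
  assumes "finite A" "Poly_Mapping.keys m \<subseteq> A"
  shows "monom_eval \<sigma> m = (\<Prod>v\<in>A. \<sigma> v ^ Poly_Mapping.lookup m v)"
  unfolding monom_eval_def using assms
  by (intro prod.mono_neutral_left) (auto simp: in_keys_iff)

lemma monom_eval_zero [simp]: "monom_eval \<sigma> 0 = 1"
  by (simp add: monom_eval_def)

lemma monom_eval_add: "monom_eval \<sigma> (m + m') = monom_eval \<sigma> m * monom_eval \<sigma> m'"
proof -
  let ?A = "Poly_Mapping.keys m \<union> Poly_Mapping.keys m'"
  have "Poly_Mapping.keys (m + m') \<subseteq> ?A" by (rule keys_add)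
  then show ?thesis
    by (simp add: monom_eval_superset[of ?A] lookup_add power_add prod.distrib)
qed

lemma eval_with_superset:
  assumes "finite A" "Poly_Mapping.keys p \<subseteq> A" "h 0 = 0"
  shows "eval_with h \<sigma> p = (\<Sum>m\<in>A. h (Poly_Mapping.lookup p m) * monom_eval \<sigma> m)"
  unfolding eval_with_def monom_eval_def using assms
  by (intro sum.mono_neutral_left) (auto simp: in_keys_iff)

lemma eval_with_single:
  assumes "h 0 = 0"
  shows "eval_with h \<sigma> (Poly_Mapping.single m c) = h c * monom_eval \<sigma> m"
  using assms by (simp add: eval_with_superset[of "{m}"])

lemma eval_with_add:
  assumes "h 0 = 0" "\<And>a b. h (a + b) = h a + h b"
  shows "eval_with h \<sigma> (p + q) = eval_with h \<sigma> p + eval_with h \<sigma> q"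
proof -
  let ?A = "Poly_Mapping.keys p \<union> Poly_Mapping.keys q"
  have "Poly_Mapping.keys (p + q) \<subseteq> ?A" by (rule keys_add)
  then show ?thesis using assms
    by (simp add: eval_with_superset[of ?A] lookup_add distrib_right sum.distrib)
qed

lemma mpoly_induct [case_names zero add_single]:
  fixes p :: "'k \<Rightarrow>\<^sub>0 'a::comm_monoid_add"
  assumes "P 0" "\<And>p m c. P p \<Longrightarrow> P (Poly_Mapping.single m c + p)"
  shows "P p"
proof -
  have *: "P (\<Sum>m\<in>A. Poly_Mapping.single m (Poly_Mapping.lookup p m))" if "finite A" for A
    using that by induction (auto intro: assms)
  have "(\<Sum>m\<in>Poly_Mapping.keys p. Poly_Mapping.single m (Poly_Mapping.lookup p m)) = p"
    by (rule poly_mapping_eqI)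
      (auto simp: lookup_sum lookup_single when_def in_keys_iff)
  with * show ?thesis by (metis finite_keys)
qed

lemma eval_with_mult:
  fixes h :: "'a::comm_semiring_1 \<Rightarrow> 'b::comm_semiring_1"
  assumes "h 0 = 0" "\<And>a b. h (a + b) = h a + h b" "\<And>a b. h (a * b) = h a * h b"
  shows "eval_with h \<sigma> (p * q) = eval_with h \<sigma> p * eval_with h \<sigma> q"
proof (induction p rule: mpoly_induct)
  case zero
  then show ?case by (simp add: eval_with_def)
next
  case (add_single p m c)
  have "eval_with h \<sigma> (Poly_Mapping.single m c * q) = h c * monom_eval \<sigma> m * eval_with h \<sigma> q"
    using assms
    by (induction q rule: mpoly_induct)
      (simp_all add: eval_with_add eval_with_single distrib_left mult_single monom_eval_add
        mult_ac, simp add: eval_with_def)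
  with add_single show ?case using assms
    by (simp add: eval_with_add eval_with_single distrib_right)
qed

lemma comm_ring_hom_eval_with:
  assumes "comm_ring_hom h"
  shows "comm_ring_hom (eval_with h \<sigma>)"
proof -
  interpret h: comm_ring_hom h by fact
  show ?thesis
  proof
    show "eval_with h \<sigma> 1 = 1"
      using eval_with_single[of h \<sigma> 0 1] by simp
    show "eval_with h \<sigma> 0 = 0" by (simp add: eval_with_def)
  qed (simp_all add: eval_with_add eval_with_mult hom_distribs)
qed

lemma eval_with_Var:
  assumes "h 0 = 0" "h 1 = 1"
  shows "eval_with h \<sigma> (Var v) = \<sigma> v"
  using assms by (simp add: Var_def eval_with_single monom_eval_def)

lemma eval_with_Const:
  assumes "h 0 = 0"
  shows "eval_with h \<sigma> (Const c) = h c"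
  using assms by (simp add: Const_def eval_with_single)

lemma comm_ring_hom_Const: "comm_ring_hom (Const :: 'a::comm_ring_1 \<Rightarrow> ('v, 'a) mpoly)"
  by standard (simp_all add: Const_def single_add mult_single)

lemma comm_ring_hom_eval_poly: "comm_ring_hom (eval_poly x)"
  unfolding eval_poly_def by (rule comm_ring_hom_eval_with) (standard, auto)

lemma comm_ring_hom_subst_poly: "comm_ring_hom (subst_poly \<sigma>)"
  unfolding subst_poly_def by (rule comm_ring_hom_eval_with[OF comm_ring_hom_Const])

lemma eval_poly_Var [simp]: "eval_poly x (Var v) = x v"
  by (simp add: eval_poly_def eval_with_Var)

lemma subst_poly_Var [simp]: "subst_poly \<sigma> (Var v) = \<sigma> v"
  by (simp add: subst_poly_def eval_with_Var Const_def)

lemma subst_poly_Const [simp]: "subst_poly \<sigma> (Const c) = Const c"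
  unfolding subst_poly_def by (rule eval_with_Const) (simp add: Const_def)

text \<open>
  Dedekind's argument: distinct monomials are distinct characters of the torus, hence linearly
  independent.
\<close>

lemma torus_independent:
  fixes c :: "(nat \<Rightarrow>\<^sub>0 nat) \<Rightarrow> complex"
  assumes "finite A" "\<And>m. m \<in> A \<Longrightarrow> Poly_Mapping.keys m \<subseteq> {..<n}"
    and "\<And>x. \<forall>i<n. x i \<noteq> 0 \<Longrightarrow> (\<Sum>m\<in>A. c m * monom_eval x m) = 0"
    and "m \<in> A"
  shows "c m = 0"
  using assms
proof (induction A arbitrary: c m rule: finite_induct)
  case empty
  then show ?case by simp
next
  case (insert m\<^sub>0 A)
  have ex: "\<exists>y. (\<forall>i<n. y i \<noteq> 0) \<and> monom_eval y m \<noteq> (monom_eval y m\<^sub>0 :: complex)" 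
    if m: "m \<in> A" for m
  proof -
    have keys: "Poly_Mapping.keys m \<subseteq> {..<n}" "Poly_Mapping.keys m\<^sub>0 \<subseteq> {..<n}"
      using insert.prems(1) m by auto
    have "m \<noteq> m\<^sub>0" using m insert.hyps by auto
    then obtain i where i: "Poly_Mapping.lookup m i \<noteq> Poly_Mapping.lookup m\<^sub>0 i"
      by (meson poly_mapping_eqI)
    then have "i < n" using keys by (metis in_keys_iff lessThan_iff subsetD)
    \<comment> \<open>The point isolates a coordinate where the exponents differ; 2 serves because
      its powers are pairwise distinct.\<close>
    let ?y = "\<lambda>j. if j = i then 2 else (1::complex)"
    have pow: "monom_eval ?y m' = 2 ^ Poly_Mapping.lookup m' i"
      if "Poly_Mapping.keys m' \<subseteq> {..<n}" for m'
    proof -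
      have "monom_eval ?y m' = (\<Prod>j<n. ?y j ^ Poly_Mapping.lookup m' j)"
        by (rule monom_eval_superset) (use that in auto)
      also have "\<dots> = (\<Prod>j<n. if j = i then 2 ^ Poly_Mapping.lookup m' j else 1)"
        by (rule prod.cong) auto
      finally show ?thesis using \<open>i < n\<close> by simp
    qed
    have "(2::complex) ^ a = 2 ^ b \<longleftrightarrow> a = b" for a b :: nat
    proof -
      have "norm ((2::complex) ^ a) = norm ((2::complex) ^ b) \<longleftrightarrow> (2::real) ^ a = 2 ^ b"
        by (simp add: norm_power)
      then show ?thesis by (metis one_less_numeral_iff power_inject_exp semiring_norm(76))
    qed
    then show ?thesis using i pow keys by (intro exI[of _ ?y]) auto
  qed
  have A: "c m = 0" if m: "m \<in> A" for m
  proof -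
    obtain y where y: "\<forall>i<n. y i \<noteq> 0" "monom_eval y m \<noteq> (monom_eval y m\<^sub>0 :: complex)"
      using ex[OF m] by auto
    \<comment> \<open>Take the relation at the pointwise product of y and x and subtract
      \<open>monom_eval y m\<^sub>0\<close> times the relation at x. The term of
      \<open>m\<^sub>0\<close> cancels, so the induction hypothesis applies to the modified
      coefficients.\<close>
    have "c m * (monom_eval y m - monom_eval y m\<^sub>0) = 0"
    proof (rule insert.IH[OF _ _ m, of "\<lambda>m. c m * (monom_eval y m - monom_eval y m\<^sub>0)"])
      fix x :: "nat \<Rightarrow> complex" assume x: "\<forall>i<n. x i \<noteq> 0"
      have mul: "monom_eval (\<lambda>i. y i * x i) m' = monom_eval y m' * (monom_eval x m' :: complex)" for m'
        by (simp add: monom_eval_def power_mult_distrib prod.distrib)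
      have "(\<Sum>m\<in>insert m\<^sub>0 A. c m * (monom_eval y m * monom_eval x m)) = 0"
        using insert.prems(2)[of "\<lambda>i. y i * x i"] x y(1) by (simp add: mul)
      moreover have "monom_eval y m\<^sub>0 * (\<Sum>m\<in>insert m\<^sub>0 A. c m * monom_eval x m) = 0"
        using insert.prems(2)[of x] x by simp
      ultimately have "(\<Sum>m\<in>insert m\<^sub>0 A. c m * (monom_eval y m - monom_eval y m\<^sub>0) * monom_eval x m) = 0"
        by (simp add: algebra_simps sum_subtractf sum_distrib_left)
      then show "(\<Sum>m\<in>A. c m * (monom_eval y m - monom_eval y m\<^sub>0) * monom_eval x m) = 0"
        using insert.hyps by simp
    qed (use insert.prems(1) in auto)
    then show ?thesis using y by simp
  qed
  moreover have "c m\<^sub>0 = 0"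
  proof -
    have "(\<Sum>m\<in>insert m\<^sub>0 A. c m * monom_eval (\<lambda>_. 1) m) = 0"
      by (rule insert.prems(2)) simp
    then show ?thesis using A insert.hyps by (simp add: monom_eval_def)
  qed
  ultimately show ?case using insert.prems(3) by auto
qed

text \<open>Supplies the uniqueness behind the definite description in
  \<open>dual_character\<close>.\<close>

lemma mpoly_eq_if_eval_eq:
  fixes p q :: "(nat, complex) mpoly"
  assumes "vars p \<subseteq> {..<n}" "vars q \<subseteq> {..<n}"
    and "\<And>x. \<forall>i<n. x i \<noteq> 0 \<Longrightarrow> eval_poly x p = eval_poly x q"
  shows "p = q"
proof (rule poly_mapping_eqI)
  fix m
  let ?A = "Poly_Mapping.keys p \<union> Poly_Mapping.keys q"
  have "Poly_Mapping.lookup p m - Poly_Mapping.lookup q m = 0" if "m \<in> ?A"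
  proof (rule torus_independent[OF _ _ _ that,
      of n "\<lambda>m. Poly_Mapping.lookup p m - Poly_Mapping.lookup q m"])
    fix x :: "nat \<Rightarrow> complex" assume "\<forall>i<n. x i \<noteq> 0"
    from assms(3)[OF this]
    have "(\<Sum>m\<in>?A. Poly_Mapping.lookup p m * monom_eval x m) =
        (\<Sum>m\<in>?A. Poly_Mapping.lookup q m * monom_eval x m)"
      by (simp add: eval_poly_def eval_with_superset[of ?A])
    then show "(\<Sum>m\<in>?A. (Poly_Mapping.lookup p m - Poly_Mapping.lookup q m) * monom_eval x m) = 0"
      by (simp add: left_diff_distrib sum_subtractf)
  qed (use assms(1,2) in \<open>auto simp: vars_def\<close>)
  then show "Poly_Mapping.lookup p m = Poly_Mapping.lookup q m"
    by (cases "m \<in> ?A") (auto simp: in_keys_iff)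
qed

section \<open>Dual characters from bases of weight vectors\<close>

text \<open>Independence in \<open>mpoly\<close> concerns sets of vectors. Together with injectivity
  it becomes independence of a family, so that coefficients can be indexed by diagrams.\<close>

lemma inj_on_independent_iff:
  fixes g :: "'c \<Rightarrow> ('v, complex) mpoly"
  assumes "finite S"
  shows "inj_on g S \<and> mpoly.independent (g ` S) \<longleftrightarrow>
    (\<forall>a. (\<Sum>C\<in>S. scale_poly (a C) (g C)) = 0 \<longrightarrow> (\<forall>C\<in>S. a C = 0))"
proof (intro iffI allI impI)
  fix a assume *: "inj_on g S \<and> mpoly.independent (g ` S)"
    and "(\<Sum>C\<in>S. scale_poly (a C) (g C)) = 0"
  then have "(\<Sum>b\<in>g ` S. scale_poly (a (inv_into S g b)) b) = 0"
    by (subst sum.reindex) (simp_all cong: sum.cong)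
  then have "a (inv_into S g b) = 0" if "b \<in> g ` S" for b
    using mpoly.independentD[of "g ` S" "g ` S" "\<lambda>b. a (inv_into S g b)"] * that assms by auto
  then show "\<forall>C\<in>S. a C = 0" using * by (metis image_eqI inv_into_f_f)
next
  assume *: "\<forall>a. (\<Sum>C\<in>S. scale_poly (a C) (g C)) = 0 \<longrightarrow> (\<forall>C\<in>S. a C = 0)"
  have inj: "inj_on g S"
  proof (rule inj_onI, rule ccontr)
    fix C C' assume C: "C \<in> S" "C' \<in> S" "g C = g C'" "C \<noteq> C'"
    let ?a = "\<lambda>c. if c = C then 1 else if c = C' then -1 else (0::complex)"
    have "(\<Sum>c\<in>S. scale_poly (?a c) (g c)) = (\<Sum>c\<in>{C, C'}. scale_poly (?a c) (g c))"
      using C assms by (intro sum.mono_neutral_right) auto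
    also have "\<dots> = 0" using C by simp
    finally show False using * C by force
  qed
  moreover have "mpoly.independent (g ` S)"
  proof (rule mpoly.independent_if_scalars_zero)
    fix f x assume "(\<Sum>x\<in>g ` S. scale_poly (f x) x) = 0" "x \<in> g ` S"
    then show "f x = 0" using *[rule_format, of "\<lambda>C. f (g C)"] inj
      by (auto simp: sum.reindex)
  qed (use assms in simp)
  ultimately show "inj_on g S \<and> mpoly.independent (g ` S)" by simp
qed

text \<open>\<open>trace_on\<close> works in a basis picked by \<open>SOME\<close>. Its base change
  matrices to and from the eigenbasis \<open>B\<close> are inverse to each other, so each eigenvalue
  enters the trace with total weight 1.\<close>

lemma trace_on_eigenbasis:
  assumes B: "finite B" "mpoly.independent B" "mpoly.span B = V"
    and add: "\<And>p q. T (p + q) = T p + T q"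
    and scale: "\<And>c p. T (scale_poly c p) = scale_poly c (T p)"
    and ev: "\<And>b. b \<in> B \<Longrightarrow> T b = scale_poly (ev b) b"
  shows "trace_on V T = (\<Sum>b\<in>B. ev b)"
proof -
  define B' where "B' = (SOME B. mpoly.independent B \<and> mpoly.span B = V)"
  have B': "mpoly.independent B'" "mpoly.span B' = V"
    using someI[of "\<lambda>B. mpoly.independent B \<and> mpoly.span B = V" B] B by (auto simp: B'_def)
  have "B' \<subseteq> mpoly.span B" using B B' mpoly.span_superset by blast
  then have fin: "finite B'" using mpoly.independent_span_bound[OF B(1) B'(1)] by simp
  let ?r = "mpoly.representation B" and ?r' = "mpoly.representation B'"
  have T0: "T 0 = 0" using add[of 0 0] by simp
  have T_sum: "T (sum f A) = (\<Sum>a\<in>A. T (f a))" for f and A :: "(('a \<Rightarrow>\<^sub>0 nat) \<Rightarrow>\<^sub>0 complex) set"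
    by (induction A rule: infinite_finite_induct) (simp_all add: T0 add)
  have inV: "v \<in> V \<Longrightarrow> v \<in> mpoly.span B" "v \<in> V \<Longrightarrow> v \<in> mpoly.span B'"
    "b \<in> B \<Longrightarrow> b \<in> V" "b \<in> B' \<Longrightarrow> b \<in> V" for v b
    using B B' mpoly.span_superset by auto
  have diag: "?r' (T b) b = (\<Sum>c\<in>B. ev c * (?r b c * ?r' c b))" if b: "b \<in> B'" for b
  proof -
    have "T b = T (\<Sum>c\<in>B. scale_poly (?r b c) c)"
      using mpoly.sum_representation_eq[of B b B] B b inV by simp
    also have "\<dots> = (\<Sum>c\<in>B. scale_poly (?r b c * ev c) c)"
      by (simp add: T_sum scale ev)
    finally show ?thesis
      using B'(1) inV by (simp add: mpoly.representation_sum mpoly.representation_scale mpoly.span_scale mult_ac)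
  qed
  have one: "(\<Sum>b\<in>B'. ?r b c * ?r' c b) = 1" if c: "c \<in> B" for c
  proof -
    have "?r c c = ?r (\<Sum>b\<in>B'. scale_poly (?r' c b) b) c"
      using mpoly.sum_representation_eq[of B' c B'] B' fin c inV by simp
    also have "\<dots> = (\<Sum>b\<in>B'. ?r' c b * ?r b c)"
      using B(2) inV by (simp add: mpoly.representation_sum mpoly.representation_scale mpoly.span_scale)
    finally show ?thesis using mpoly.representation_basis[OF B(2) c] by (simp add: mult.commute)
  qed
  have "trace_on V T = (\<Sum>b\<in>B'. ?r' (T b) b)"
    by (simp add: trace_on_def B'_def Let_def)
  also have "\<dots> = (\<Sum>b\<in>B'. \<Sum>c\<in>B. ev c * (?r b c * ?r' c b))"
    by (intro sum.cong refl diag)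
  also have "\<dots> = (\<Sum>c\<in>B. ev c * (\<Sum>b\<in>B'. ?r b c * ?r' c b))"
    by (subst sum.swap) (simp add: sum_distrib_left)
  also have "\<dots> = (\<Sum>c\<in>B. ev c)" by (simp add: one)
  finally show ?thesis .
qed

section \<open>Torus weights of the products of minors\<close>

lemma det_mult_rows:
  fixes A :: "'a::comm_ring_1 mat"
  assumes "A \<in> carrier_mat d d"
  shows "det (mat d d (\<lambda>(s, t). c s * A $$ (s, t))) = (\<Prod>s<d. c s) * det A"
proof -
  have "det (mat d d (\<lambda>(s, t). c s * A $$ (s, t))) =
      (\<Sum>p\<in>{p. p permutes {0..<d}}. signof p * (\<Prod>i=0..<d. c i * A $$ (i, p i)))"
    by (subst det_def'[of _ d]) (auto intro!: sum.cong prod.cong simp: permutes_in_image[of _ "{0..<d}", simplified])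
  then show ?thesis
    by (simp add: det_def'[OF assms] prod.distrib sum_distrib_left atLeast0LessThan mult_ac)
qed

lemma submatrix_Ymat:
  assumes "I \<subseteq> {..<n}" "J \<subseteq> {..<n}"
  shows "submatrix (Ymat n) I J = mat (card I) (card J)
    (\<lambda>(s, t). if pick I s \<le> pick J t then Var (pick I s, pick J t) else 0)"
proof -
  have "{i. i < n \<and> i \<in> I} = I" "{j. j < n \<and> j \<in> J} = J" using assms by auto
  moreover have "pick I s < n" if "s < card I" for s using pick_in_set that assms by blast
  moreover have "pick J s < n" if "s < card J" for s using pick_in_set that assms by blast
  ultimately show ?thesis
    by (intro eq_matI) (auto simp: submatrix_def Ymat_def)
qed

lemma submatrix_Ymat_carrier:
  assumes "I \<subseteq> {..<n}" "J \<subseteq> {..<n}" "card I = card J"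
  shows "submatrix (Ymat n) I J \<in> carrier_mat (card J) (card J)"
  using assms by (simp add: submatrix_Ymat)

definition weyl_gen :: "nat \<Rightarrow> diagram \<Rightarrow> diagram \<Rightarrow> (nat \<times> nat, complex) mpoly" where
  "weyl_gen n D C = (\<Prod>j<n. det (submatrix (Ymat n) (column C j) (column D j)))"

lemma weyl_module_eq: "weyl_module n D = mpoly.span (weyl_gen n D ` {C. diagram_le n C D})"
  by (simp add: weyl_module_def weyl_gen_def setcompr_eq_image)

lemma column_subset:
  assumes "C \<in> diagrams n"
  shows "column C j \<subseteq> {..<n}"
  using assms by (auto simp: column_def diagrams_def)

lemma finite_column:
  assumes "C \<in> diagrams n"
  shows "finite (column C j)"
  using column_subset[OF assms] finite_subset by blast

lemma finite_diagram:
  assumes "C \<in> diagrams n"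
  shows "finite C"
  using assms by (auto simp: diagrams_def intro: finite_subset)

lemma finite_diagram_le: "finite {C. diagram_le n C D}"
  by (rule finite_subset[of _ "diagrams n"]) (auto simp: diagram_le_def diagrams_def)

lemma prod_columns:
  assumes "C \<in> diagrams n"
  shows "(\<Prod>j<n. \<Prod>i\<in>column C j. f i j) = (\<Prod>(i, j)\<in>C. f i j)"
proof -
  have "(\<Prod>j<n. \<Prod>i\<in>column C j. f i j) = (\<Prod>(j, i)\<in>(SIGMA j:{..<n}. column C j). f i j)"
    by (subst prod.Sigma) (auto simp: finite_column[OF assms])
  also have "\<dots> = (\<Prod>(i, j)\<in>C. f i j)"
    using assms
    by (intro prod.reindex_bij_witness[of _ prod.swap prod.swap])
      (auto simp: column_def diagrams_def)
  finally show ?thesis .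
qed

text \<open>\<open>mat_inverse\<close> is accessible only through its specification: invertibility
  excludes \<open>None\<close>, and uniqueness of inverses identifies the result.\<close>

lemma mat_inverse_diag:
  fixes x :: "nat \<Rightarrow> 'a::field"
  assumes "\<forall>i<n. x i \<noteq> 0"
  shows "mat_inverse (mat_diag n (\<lambda>i. inverse (x i))) = Some (mat_diag n x)"
proof -
  let ?A = "mat_diag n (\<lambda>i. inverse (x i))" and ?X = "mat_diag n x"
  have AX: "?A * ?X = 1\<^sub>m n" "?X * ?A = 1\<^sub>m n"
    using assms by (simp_all add: mat_diag_diag) (auto simp: mat_diag_def intro!: eq_matI)
  have "?A \<in> Units (ring_mat TYPE('a) n b)" for b
    unfolding Units_def ring_mat_simps using AX by (auto intro!: bexI[of _ ?X])
  then obtain B where B: "mat_inverse ?A = Some B"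
    using mat_inverse(1)[of ?A n] by fastforce
  then have "?A * B = 1\<^sub>m n" "B \<in> carrier_mat n n"
    using mat_inverse(2)[of ?A n B] by auto
  then have "B = (?X * ?A) * B" unfolding AX(2) by simp
  also have "\<dots> = ?X * (?A * B)"
    by (rule assoc_mult_mat[of _ n n _ n _ n]) (use \<open>B \<in> carrier_mat n n\<close> in simp_all)
  also have "\<dots> = ?X" unfolding \<open>?A * B = 1\<^sub>m n\<close>
    by (rule right_mult_one_mat[OF mat_diag_dim])
  finally show ?thesis using B by simp
qed

text \<open>The inversion of the arguments and the inverse in the action cancel. Row i of
  \<open>Ymat\<close> is multiplied by x_i, and each minor collects the factors of the rows that it
  uses.\<close>

lemma borel_act_weyl_gen:
  assumes "diagram_le n C D" and x: "\<forall>i<n. x i \<noteq> 0"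
  shows "borel_act n (mat_diag n (\<lambda>i. inverse (x i))) (weyl_gen n D C) =
    scale_poly (\<Prod>(i, j)\<in>C. x i) (weyl_gen n D C)"
proof -
  define \<sigma> where "\<sigma> = (\<lambda>ij. (map_mat Const (mat_diag n x) * Ymat n) $$ ij)"
  interpret \<sigma>: comm_ring_hom "subst_poly \<sigma>" by (rule comm_ring_hom_subst_poly)
  interpret Const: comm_ring_hom "Const :: complex \<Rightarrow> (nat \<times> nat, complex) mpoly"
    by (rule comm_ring_hom_Const)
  have "map_mat Const (mat_diag n x) = (mat_diag n (\<lambda>i. Const (x i)) :: (nat \<times> nat, complex) mpoly mat)"
    by (intro eq_matI) (auto simp: mat_diag_def)
  then have \<sigma>: "\<sigma> (i, j) = Const (x i) * Var (i, j)" if "i \<le> j" "j < n" for i j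
    using that by (simp add: \<sigma>_def mat_diag_mult_left[of _ n n] Ymat_def)
  have CD: "C \<in> diagrams n" "D \<in> diagrams n" and card: "\<And>j. j < n \<Longrightarrow> card (column C j) = card (column D j)"
    using assms by (auto simp: diagram_le_def set_le_def)
  have "subst_poly \<sigma> (det (submatrix (Ymat n) (column C j) (column D j))) =
      (\<Prod>i\<in>column C j. Const (x i)) * det (submatrix (Ymat n) (column C j) (column D j))"
    if j: "j < n" for j
  proof -
    let ?I = "column C j" and ?J = "column D j"
    let ?A = "submatrix (Ymat n) ?I ?J"
    have IJ: "?I \<subseteq> {..<n}" "?J \<subseteq> {..<n}" using CD column_subset by auto
    have "pick ?J s < n" if "s < card ?J" for s using pick_in_set that IJ by blast
    then have "map_mat (subst_poly \<sigma>) ?A =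
        mat (card ?J) (card ?J) (\<lambda>(s, t). Const (x (pick ?I s)) * ?A $$ (s, t))"
      using \<sigma> card[OF j] by (intro eq_matI) (auto simp: submatrix_Ymat[OF IJ])
    then have "subst_poly \<sigma> (det ?A) = (\<Prod>s<card ?I. Const (x (pick ?I s))) * det ?A"
      using det_mult_rows[OF submatrix_Ymat_carrier[OF IJ card[OF j]]] card[OF j]
      by (simp flip: \<sigma>.hom_det)
    also have "(\<Prod>s<card ?I. Const (x (pick ?I s))) = (\<Prod>i\<in>?I. Const (x i))"
      by (rule prod.reindex_bij_betw[OF bij_betw_pick]) (rule finite_column[OF CD(1)])
    finally show ?thesis .
  qed
  then have "subst_poly \<sigma> (weyl_gen n D C) =
      (\<Prod>j<n. \<Prod>i\<in>column C j. Const (x i)) * weyl_gen n D C"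
    by (simp add: weyl_gen_def \<sigma>.hom_prod prod.distrib)
  also have "(\<Prod>j<n. \<Prod>i\<in>column C j. Const (x i)) =
      (Const (\<Prod>(i, j)\<in>C. x i) :: (nat \<times> nat, complex) mpoly)"
    by (simp add: prod_columns[OF CD(1)] Const.hom_prod case_prod_unfold)
  finally show ?thesis
    by (simp add: borel_act_def mat_inverse_diag[OF x] scale_poly_def \<sigma>_def)
qed

section \<open>The dual character as a sum of diagram monomials\<close>

definition diagram_monom :: "diagram \<Rightarrow> (nat, complex) mpoly" where
  "diagram_monom C = (\<Prod>(i, j)\<in>C. Var i)"

lemma vars_add: "vars (p + q) \<subseteq> vars p \<union> vars q"
  using keys_add[of p q] by (auto simp: vars_def)

lemma vars_mult:
  fixes p q :: "('v, 'a::comm_semiring_1) mpoly"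
  shows "vars (p * q) \<subseteq> vars p \<union> vars q"
proof
  fix v assume "v \<in> vars (p * q)"
  then obtain m where "m \<in> Poly_Mapping.keys (p * q)" "v \<in> Poly_Mapping.keys m"
    by (auto simp: vars_def)
  moreover then obtain a b where "m = a + b" "a \<in> Poly_Mapping.keys p" "b \<in> Poly_Mapping.keys q"
    using keys_mult[of p q] by auto
  ultimately show "v \<in> vars p \<union> vars q" using keys_add[of a b] by (auto simp: vars_def)
qed

lemma nonneg_int_polys_add:
  assumes "p \<in> nonneg_int_polys n" "q \<in> nonneg_int_polys n"
  shows "p + q \<in> nonneg_int_polys n"
  using assms vars_add[of p q] by (auto simp: nonneg_int_polys_def lookup_add)

lemma nonneg_int_polys_sum:
  assumes "\<And>a. a \<in> A \<Longrightarrow> f a \<in> nonneg_int_polys n"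
  shows "sum f A \<in> nonneg_int_polys n"
proof -
  have "(0 :: (nat, complex) mpoly) \<in> nonneg_int_polys n"
    by (simp add: nonneg_int_polys_def vars_def)
  then show ?thesis using assms
    by (induction A rule: infinite_finite_induct) (auto intro: nonneg_int_polys_add)
qed

lemma diagram_monom_nonneg:
  assumes "C \<in> diagrams n"
  shows "diagram_monom C \<in> nonneg_int_polys n"
proof -
  have "finite C" "C \<subseteq> {..<n} \<times> {..<n}"
    using assms finite_diagram by (auto simp: diagrams_def)
  then have "vars (diagram_monom C) \<subseteq> {..<n} \<and> (\<exists>m. diagram_monom C = Poly_Mapping.single m 1)"
  proof (induction C rule: finite_induct)
    case empty
    then show ?case by (auto simp: diagram_monom_def vars_def intro: exI[of _ 0])
  next
    case (insert b C)
    have "diagram_monom (insert b C) = Var (fst b) * diagram_monom C"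
      using insert by (simp add: diagram_monom_def case_prod_unfold)
    moreover have "vars (Var (fst b) :: (nat, complex) mpoly) \<subseteq> {..<n}"
      using insert by (auto simp: vars_def Var_def)
    ultimately show ?case
      using insert vars_mult[of "Var (fst b)" "diagram_monom C"]
      by (auto simp: Var_def mult_single)
  qed
  then show ?thesis by (auto simp: nonneg_int_polys_def lookup_single when_def)
qed

text \<open>The trace in an eigenbasis shows that the sum has the required values on the torus, and
  \<open>mpoly_eq_if_eval_eq\<close> that no other polynomial has them; both are needed to evaluate
  the \<open>THE\<close>.\<close>

lemma dual_character_eq:
  assumes S: "S \<subseteq> {C. diagram_le n C D}"
    and inj: "inj_on (weyl_gen n D) S"
    and indep: "mpoly.independent (weyl_gen n D ` S)"
    and span: "weyl_gen n D ` {C. diagram_le n C D} \<subseteq> mpoly.span (weyl_gen n D ` S)"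
  shows "dual_character n D = (\<Sum>C\<in>S. diagram_monom C)"
proof -
  let ?p = "\<Sum>C\<in>S. diagram_monom C"
  have fin: "finite S" using S finite_diagram_le finite_subset by blast
  have "?p \<in> nonneg_int_polys n"
    using S by (intro nonneg_int_polys_sum diagram_monom_nonneg) (auto simp: diagram_le_def)
  then have vars: "vars ?p \<subseteq> {..<n}" by (simp add: nonneg_int_polys_def)
  have eval: "eval_poly x ?p = weyl_character n D (\<lambda>i. inverse (x i))" if x: "\<forall>i<n. x i \<noteq> 0" for x
  proof -
    interpret ev: comm_ring_hom "eval_poly x" by (rule comm_ring_hom_eval_poly)
    let ?T = "borel_act n (mat_diag n (\<lambda>i. inverse (x i)))"
    let ?w = "\<lambda>C. \<Prod>(i, j)\<in>C. x i"
    \<comment> \<open>Weights belong to diagrams, eigenvalues to vectors; injectivity on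
      \<open>S\<close> allows the way back.\<close>
    let ?ev = "\<lambda>b. ?w (inv_into S (weyl_gen n D) b)"
    have V: "mpoly.span (weyl_gen n D ` S) = weyl_module n D"
      unfolding weyl_module_eq using S span
      by (intro subset_antisym mpoly.span_mono mpoly.span_minimal) auto
    have "trace_on (weyl_module n D) ?T = (\<Sum>b\<in>weyl_gen n D ` S. ?ev b)"
    proof (rule trace_on_eigenbasis[OF _ indep V])
      fix p q :: "(nat \<times> nat, complex) mpoly" and c
      interpret s: comm_ring_hom "?T"
        unfolding borel_act_def by (rule comm_ring_hom_subst_poly)
      show "?T (p + q) = ?T p + ?T q" by (rule s.hom_add)
      show "?T (scale_poly c p) = scale_poly c (?T p)"
        unfolding scale_poly_def s.hom_mult by (simp add: borel_act_def)
    next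
      fix b assume "b \<in> weyl_gen n D ` S"
      then show "?T b = scale_poly (?ev b) b"
        using S inj borel_act_weyl_gen[OF _ x] by auto
    qed (use fin in simp)
    also have "\<dots> = (\<Sum>C\<in>S. ?w C)" using inj by (simp add: sum.reindex)
    also have "\<dots> = eval_poly x ?p"
      by (simp add: ev.hom_sum diagram_monom_def ev.hom_prod case_prod_unfold)
    finally show ?thesis by (simp add: weyl_character_def)
  qed
  show ?thesis
    unfolding dual_character_def
  proof (rule the_equality)
    fix q assume q: "vars q \<subseteq> {..<n} \<and> (\<forall>x. (\<forall>i<n. x i \<noteq> 0) \<longrightarrow>
      eval_poly x q = weyl_character n D (\<lambda>i. inverse (x i)))"
    show "q = ?p"
      by (rule mpoly_eq_if_eval_eq[of _ n]) (use q vars eval in simp_all)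
  qed (use vars eval in simp)
qed

section \<open>Leading terms of minors\<close>

lemma mat_delete_submatrix_Ymat:
  assumes IJ: "I \<subseteq> {..<n}" "J \<subseteq> {..<n}" and i: "i < card I" and j: "j < card J"
  shows "mat_delete (submatrix (Ymat n) I J) i j =
    submatrix (Ymat n) (I - {pick I i}) (J - {pick J j})"
proof -
  have fin: "finite I" "finite J" using IJ finite_subset by blast+
  have mem: "pick I i \<in> I" "pick J j \<in> J" using i j pick_in_set by auto
  have "I - {pick I i} \<subseteq> {..<n}" "J - {pick J j} \<subseteq> {..<n}" using IJ by auto
  note sub = submatrix_Ymat[OF this] submatrix_Ymat[OF IJ]
  show ?thesis
    using mem i j
    by (intro eq_matI)
      (auto simp: sub mat_delete_def card_Diff_singleton pick_Diff[OF fin(1) i] pick_Diff[OF fin(2) j])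
qed

text \<open>
  The rows used in column k are recorded as powers of a new variable.  The largest possible power
  singles out one term of the Laplace expansion along column k.
\<close>

definition grade_column ::
    "nat \<Rightarrow> (nat \<times> nat, complex) mpoly \<Rightarrow> (nat \<times> nat, complex) mpoly poly" where
  "grade_column k = eval_with (\<lambda>c. [:Const c:])
     (\<lambda>(i, j). if j = k then monom 1 i else [:Var (i, j):])"

lemma comm_ring_hom_grade_column: "comm_ring_hom (grade_column k)"
  unfolding grade_column_def
proof (rule comm_ring_hom_eval_with)
  interpret Const: comm_ring_hom "Const :: complex \<Rightarrow> (nat \<times> nat, complex) mpoly"
    by (rule comm_ring_hom_Const)
  show "comm_ring_hom (\<lambda>c. [:Const c :: (nat \<times> nat, complex) mpoly:])"
    by standard (simp_all add: Const.hom_add Const.hom_mult one_pCons)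
qed

lemma grade_column_Var:
  "grade_column k (Var (i, j)) = (if j = k then monom 1 i else [:Var (i, j):])"
  unfolding grade_column_def
  by (subst eval_with_Var) (simp_all add: Const_def one_pCons)

lemma grade_column_Const: "grade_column k (Const c) = [:Const c:]"
  unfolding grade_column_def by (subst eval_with_Const) (simp_all add: Const_def)

lemma grade_column_det_const:
  assumes "I \<subseteq> {..<n}" "J \<subseteq> {..<n}" "k \<notin> J"
  shows "grade_column k (det (submatrix (Ymat n) I J)) = [:det (submatrix (Ymat n) I J):]"
proof -
  interpret g: comm_ring_hom "grade_column k" by (rule comm_ring_hom_grade_column)
  interpret c: comm_ring_hom "\<lambda>p :: (nat \<times> nat, complex) mpoly. [:p:]"
    by standard (simp_all add: one_pCons)
  have "pick J t \<noteq> k" if "t < card J" for t using pick_in_set that assms by metis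
  then have "map_mat (grade_column k) (submatrix (Ymat n) I J) =
      map_mat (\<lambda>p. [:p:]) (submatrix (Ymat n) I J)"
    by (intro eq_matI) (auto simp: submatrix_Ymat[OF assms(1,2)] grade_column_Var)
  then show ?thesis by (metis g.hom_det c.hom_det)
qed

text \<open>Expand along column k. The cofactors are constant in the new variable, the entry in row
  i has degree i, and entries in rows beyond k vanish. By \<open>max\<close>, no row of
  \<open>I\<close> lies strictly between r and k or equals k unless r = k, so the term of row r is
  on top.\<close>

lemma grade_column_det_leading:
  assumes I: "I \<subseteq> {..<n}" and J: "J \<subseteq> {..<n}" and card: "card I = card J"
    and k: "k \<in> J" and r: "r \<in> I" "r \<le> k" and max: "\<And>i. i \<in> I \<Longrightarrow> i \<le> k \<Longrightarrow> i \<le> r"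
  obtains s :: complex where "s \<noteq> 0"
    "coeff (grade_column k (det (submatrix (Ymat n) I J))) r =
      Const s * det (submatrix (Ymat n) (I - {r}) (J - {k}))"
    "degree (grade_column k (det (submatrix (Ymat n) I J))) \<le> r"
proof -
  interpret g: comm_ring_hom "grade_column k" by (rule comm_ring_hom_grade_column)
  have fin: "finite I" "finite J" using I J finite_subset by blast+
  let ?A = "submatrix (Ymat n) I J"
  let ?m = "\<lambda>i. det (submatrix (Ymat n) (I - {pick I i}) (J - {k}))"
  define c where "c = card {a \<in> J. a < k}"
  have "{a \<in> J. a < k} \<subset> J" using k by auto
  then have c: "c < card J" using fin by (simp add: c_def psubset_card_mono)
  have pick_c: "pick J c = k" using pick_card_in_set[OF k] by (simp add: c_def)
  define r' where "r' = card {a \<in> I. a < r}"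
  have "{a \<in> I. a < r} \<subset> I" using r by auto
  then have r': "r' < card I" using fin by (simp add: r'_def psubset_card_mono)
  have pick_r': "pick I r' = r" using pick_card_in_set[OF r(1)] by (simp add: r'_def)
  have entry: "grade_column k (?A $$ (i, c)) = (if pick I i \<le> k then monom 1 (pick I i) else 0)"
    if "i < card I" for i
    using that c by (simp add: submatrix_Ymat[OF I J] pick_c grade_column_Var)
  have minor: "grade_column k (?m i) = [:?m i:]" for i
    using I J by (intro grade_column_det_const) auto
  have sign: "grade_column k ((-1) ^ a) = [:(-1) ^ a:]" for a
    by (induction a) (simp_all add: g.hom_mult g.hom_uminus one_pCons)
  have "det ?A = (\<Sum>i<card I. ?A $$ (i, c) * ((-1) ^ (i + c) * ?m i))"
    using laplace_expansion_column[OF submatrix_Ymat_carrier[OF I J card] c] card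
      mat_delete_submatrix_Ymat[OF I J _ c] pick_c
    by (simp add: cofactor_def)
  then have expand: "grade_column k (det ?A) =
      (\<Sum>i<card I. if pick I i \<le> k then monom ((-1) ^ (i + c) * ?m i) (pick I i) else 0)"
    by (auto simp: g.hom_sum g.hom_mult entry minor sign smult_monom intro!: sum.cong)
  \<comment> \<open>Different rows carry different degrees, so only position r' contributes to the
    coefficient at r.\<close>
  have inj: "pick I i = r \<longleftrightarrow> i = r'" if "i < card I" for i
    using bij_betw_pick[OF fin(1)] that r' pick_r' by (metis bij_betw_def inj_onD lessThan_iff)
  have "coeff (grade_column k (det ?A)) r =
      (\<Sum>i<card I. if i = r' then (-1) ^ (r' + c) * ?m r' else 0)"
    unfolding expand coeff_sum using inj r pick_r' by (intro sum.cong) auto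
  also have "\<dots> = (-1) ^ (r' + c) * det (submatrix (Ymat n) (I - {r}) (J - {k}))"
    using r' by (simp add: pick_r')
  also have "(-1) ^ (r' + c) = (Const ((-1) ^ (r' + c)) :: (nat \<times> nat, complex) mpoly)"
  proof -
    interpret Const: comm_ring_hom "Const :: complex \<Rightarrow> (nat \<times> nat, complex) mpoly"
      by (rule comm_ring_hom_Const)
    show ?thesis by (simp add: Const.hom_power Const.hom_uminus)
  qed
  finally have coeff: "coeff (grade_column k (det ?A)) r =
    Const ((-1) ^ (r' + c)) * det (submatrix (Ymat n) (I - {r}) (J - {k}))" .
  have "degree (grade_column k (det ?A)) \<le> r"
    unfolding expand
  proof (rule degree_sum_le)
    fix i assume "i \<in> {..<card I}"
    then have "pick I i \<in> I" using pick_in_set by auto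
    then show "degree (if pick I i \<le> k then monom ((-1) ^ (i + c) * ?m i) (pick I i) else 0) \<le> r"
      using max[of "pick I i"] degree_monom_le[of "(-1) ^ (i + c) * ?m i" "pick I i"]
      by (auto intro: order_trans)
  qed simp
  with coeff show ?thesis by (intro that[of "(-1) ^ (r' + c)"]) auto
qed

text \<open>Any other pair of degrees with sum a + b exceeds one of the two bounds.\<close>

lemma coeff_mult_at_degree_bounds:
  fixes p q :: "'a::comm_semiring_1 poly"
  assumes "degree p \<le> a" "degree q \<le> b"
  shows "coeff (p * q) (a + b) = coeff p a * coeff q b"
proof -
  have "coeff (p * q) (a + b) = (\<Sum>i\<le>a + b. coeff p i * coeff q (a + b - i))"
    by (rule coeff_mult)
  also have "\<dots> = (\<Sum>i\<in>{a}. coeff p i * coeff q (a + b - i))"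
  proof (intro sum.mono_neutral_right ballI)
    fix i assume "i \<in> {..a + b} - {a}"
    then consider "i > a" | "a + b - i > b" by force
    then show "coeff p i * coeff q (a + b - i) = 0"
      using assms by cases (simp_all add: coeff_eq_0)
  qed auto
  finally show ?thesis by simp
qed

lemma coeff_prod_at_degree_bounds:
  fixes p :: "'i \<Rightarrow> 'a::comm_semiring_1 poly"
  assumes "\<And>j. j \<in> A \<Longrightarrow> degree (p j) \<le> d j"
  shows "coeff (\<Prod>j\<in>A. p j) (\<Sum>j\<in>A. d j) = (\<Prod>j\<in>A. coeff (p j) (d j))"
    and "degree (\<Prod>j\<in>A. p j) \<le> (\<Sum>j\<in>A. d j)"
  using assms
proof (induction A rule: infinite_finite_induct)
  case (insert x F)
  {
    case 1
    then show ?case using insert by (simp add: coeff_mult_at_degree_bounds)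
  next
    case 2
    then show ?case using insert
      by (auto intro!: order_trans[OF degree_mult_le] add_mono)
  }
qed auto

text \<open>Set the variables at the positions \<open>(pick I t, pick J t)\<close> to 1 and all
  others to 0: the submatrix becomes the identity. By \<open>set_le\<close> these positions lie on
  or above the diagonal of \<open>Ymat\<close>, where the variables are.\<close>

lemma det_submatrix_Ymat_nonzero:
  assumes IJ: "I \<subseteq> {..<n}" "J \<subseteq> {..<n}" and le: "set_le I J"
  shows "det (submatrix (Ymat n) I J) \<noteq> 0"
proof -
  have fin: "finite I" "finite J" using IJ finite_subset by blast+
  have card: "card I = card J" and pick_le: "\<And>t. t < card I \<Longrightarrow> pick I t \<le> pick J t"
    using le set_le_iff_pick[OF fin] by auto
  define y where "y = (\<lambda>(a, b). if \<exists>t<card I. a = pick I t \<and> b = pick J t then 1 else (0::complex))"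
  interpret ev: comm_ring_hom "eval_poly y" by (rule comm_ring_hom_eval_poly)
  have inj: "pick I s = pick I t \<longleftrightarrow> s = t" "pick J s = pick J t \<longleftrightarrow> s = t"
    if "s < card I" "t < card I" for s t
    using that bij_betw_pick[OF fin(1)] bij_betw_pick[OF fin(2)] card
    by (metis bij_betw_def inj_onD lessThan_iff)+
  have "y (pick I s, pick J t) = (if s = t then 1 else 0)" if "s < card I" "t < card I" for s t
    using that inj by (auto simp: y_def)
  then have "map_mat (eval_poly y) (submatrix (Ymat n) I J) = 1\<^sub>m (card J)"
    using card pick_le by (intro eq_matI) (auto simp: submatrix_Ymat[OF IJ])
  then have "eval_poly y (det (submatrix (Ymat n) I J)) = 1"
    by (simp flip: ev.hom_det)
  then show ?thesis by auto
qed

section \<open>Purple boxes\<close>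

lemma hat_in_diagrams:
  assumes "D \<in> diagrams n"
  shows "hat k l D \<in> diagrams n"
  using assms by (auto simp: hat_def diagrams_def)

lemma column_hat: "column (hat k l D) j = (if j = l then {} else column D j - {k})"
  by (auto simp: column_def hat_def)

lemma column_Diff_hat:
  "column (D - hat k l D) j = (if j = l then column D l else column D j \<inter> {k})"
  by (auto simp: column_def hat_def)

lemma column_Un: "column (C \<union> C') j = column C j \<union> column C' j"
  by (auto simp: column_def)

lemma diagram_le_refl: "D \<in> diagrams n \<Longrightarrow> diagram_le n D D"
  by (simp add: diagram_le_def)

lemma Purple_le:
  assumes "D \<in> diagrams n" "K \<in> Purple n k l D"
  shows "diagram_le n K (D - hat k l D)"
  using assms(2)
proof induction
  case base
  show ?case using assms(1) by (intro diagram_le_refl) (auto simp: diagrams_def)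
next
  case (step K K')
  then show ?case unfolding diagram_le_def using set_le_trans by blast
qed

text \<open>The exception is harmless: boxes of \<open>D - hat k l D\<close> lie in row k or column
  l.\<close>

lemma Purple_subset: "K \<in> Purple n k l D \<Longrightarrow> K = D - hat k l D \<or> K \<subseteq> purple n k l D"
  by (induction rule: Purple.induct) auto

text \<open>If c \<open>\<ge>\<close> r, then moving the box (c, j) up to row r shows that (r, j) is not purple.\<close>

lemma purple_bound:
  assumes D: "D \<in> diagrams n" and rj: "(r, j) \<in> purple n k l D" and j: "j < n" "j \<noteq> l"
    and r: "r < k" and c: "c \<in> column D j" "c \<noteq> k"
  shows "c < r"
proof (rule ccontr)
  assume "\<not> c < r"
  then have rc: "r \<le> c" by simp
  have no: "\<not> (\<exists>C. diagram_le n C D \<and> diagram_le n (hat k l C) (hat k l D) \<and> (r, j) \<in> hat k l C)"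
    using rj by (auto simp: purple_def)
  have hatD: "hat k l D \<in> diagrams n" using D by (rule hat_in_diagrams)
  show False
  proof (cases "(r, j) \<in> D")
    case True
    then have "(r, j) \<in> hat k l D" using r j by (auto simp: hat_def)
    then show False using no diagram_le_refl[OF D] diagram_le_refl[OF hatD] by blast
  next
    case False
    define C where "C = insert (r, j) (D - {(c, j)})"
    have cj: "(c, j) \<in> D" using c by (simp add: column_def)
    have rD: "r \<notin> column D j" using False by (simp add: column_def)
    have "c < n" using cj D by (auto simp: diagrams_def)
    have C: "C \<in> diagrams n" using D j rc \<open>c < n\<close> by (auto simp: C_def diagrams_def)
    have move: "set_le (insert r (A - {c})) A" if "finite A" "c \<in> A" "r \<notin> A" for A
    proof -
      have "set_le (insert r (A - {c})) (insert c (A - {c}))"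
        using that rc by (intro set_le_insert) auto
      then show ?thesis using that by (simp add: insert_absorb)
    qed
    have colC: "column C i = (if i = j then insert r (column D j - {c}) else column D i)" for i
      by (auto simp: C_def column_def)
    \<comment> \<open>As r and c differ from k and j from l, moving the box commutes with
      \<open>hat\<close>.\<close>
    have colhatC: "column (hat k l C) i =
        (if i = j then insert r (column (hat k l D) j - {c}) else column (hat k l D) i)" for i
      using r j by (auto simp: column_hat colC)
    have "diagram_le n C D"
      unfolding diagram_le_def using C D finite_column[OF D] c rD
      by (auto simp: colC intro!: move)
    moreover have "diagram_le n (hat k l C) (hat k l D)"
      unfolding diagram_le_def
    proof (intro conjI allI impI)
      fix i assume "i < n"
      show "set_le (column (hat k l C) i) (column (hat k l D) i)"
      proof (cases "i = j")
        case True
        have "set_le (insert r (column (hat k l D) j - {c})) (column (hat k l D) j)"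
          using finite_column[OF D] c rD j by (intro move) (auto simp: column_hat)
        then show ?thesis using True colhatC[of i] by simp
      qed (simp add: colhatC)
    qed (use C D hat_in_diagrams in auto)
    moreover have "(r, j) \<in> hat k l C" using r j by (auto simp: C_def hat_def)
    ultimately show False using no by blast
  qed
qed

text \<open>Here \<open>D - hat k l D\<close> has only row k in column j, so \<open>K\<close> has
  one row r, at most k. If r differs from k, the box is outside the starting diagram, hence purple,
  and \<open>purple_bound\<close> applies.\<close>

lemma Purple_column:
  assumes D: "D \<in> diagrams n" and K: "K \<in> Purple n k l D" and j: "j < n" "j \<noteq> l"
    and k: "k \<in> column D j"
  obtains r where "column K j = {r}" "r \<le> k" "r = k \<or> (\<forall>c \<in> column D j - {k}. c < r)"
proof -
  have "set_le (column K j) {k}"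
    using Purple_le[OF D K] j k by (auto simp: diagram_le_def column_Diff_hat)
  then obtain r where r: "column K j = {r}" "r \<le> k" by (rule set_le_singletonD)
  moreover have "c < r" if "r \<noteq> k" "c \<in> column D j - {k}" for c
  proof -
    have "(r, j) \<in> K" using r by (auto simp: column_def)
    moreover have "(r, j) \<notin> D - hat k l D" using \<open>r \<noteq> k\<close> j by (auto simp: hat_def)
    ultimately have "(r, j) \<in> purple n k l D" using Purple_subset[OF K] by auto
    then show "c < r" using purple_bound[OF D _ j] r that by auto
  qed
  ultimately show ?thesis using that by blast
qed

section \<open>Adding \<open>K\<close> to the diagrams below \<open>hat k l D\<close>\<close>

locale purple_shift =
  fixes n k l :: nat and D K :: diagram
  assumes D: "D \<in> diagrams n" and l: "l < n" and K: "K \<in> Purple n k l D"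
begin

text \<open>These are the diagrams whose monomials survive x_k = 0.\<close>

definition row_free :: "diagram set" where
  "row_free = {C. diagram_le n C (hat k l D) \<and> (\<forall>j. (k, j) \<notin> C)}"

lemma K_diagram: "K \<in> diagrams n"
  using Purple_le[OF D K] by (simp add: diagram_le_def)

lemma row_free_diagram: "C \<in> row_free \<Longrightarrow> C \<in> diagrams n"
  by (simp add: row_free_def diagram_le_def)

lemma row_free_le:
  "C \<in> row_free \<Longrightarrow> j < n \<Longrightarrow> set_le (column C j) (column (hat k l D) j)"
  by (simp add: row_free_def diagram_le_def)

lemma column_l:
  assumes "C \<in> row_free"
  shows "column C l = {}" "set_le (column K l) (column D l)"
  using row_free_le[OF assms l] set_le_empty_iff[OF finite_column[OF row_free_diagram[OF assms]]]
    Purple_le[OF D K] l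
  by (auto simp: column_hat column_Diff_hat diagram_le_def)

lemma column_without_k:
  assumes "j < n" "j \<noteq> l" "k \<notin> column D j"
  shows "column K j = {}"
  using Purple_le[OF D K] assms set_le_empty_iff[OF finite_column[OF K_diagram]]
  by (auto simp: diagram_le_def column_Diff_hat)

text \<open>For r = k the bound is immediate and \<open>C\<close> avoids row k. Otherwise r exceeds
  every row of \<open>hat k l D\<close> in column j, and \<open>set_le_bound\<close> passes this on
  to \<open>C\<close>. The last conclusion is the maximality asked for in
  \<open>grade_column_det_leading\<close>.\<close>

lemma column_with_k:
  assumes C: "C \<in> row_free" and j: "j < n" "j \<noteq> l" and k: "k \<in> column D j"
  obtains r where "column K j = {r}" "r \<le> k" "r \<notin> column C j"
    "\<forall>i \<in> column C j. i \<le> k \<longrightarrow> i \<le> r"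
proof -
  obtain r where r: "column K j = {r}" "r \<le> k" "r = k \<or> (\<forall>c \<in> column D j - {k}. c < r)"
    using Purple_column[OF D K j k] by blast
  have "k \<notin> column C j" using C by (auto simp: row_free_def column_def)
  have "r = k \<or> (\<forall>i \<in> column C j. i < r)"
  proof (rule disjCI)
    assume "\<not> (\<forall>i \<in> column C j. i < r)"
    then obtain i where i: "i \<in> column C j" "\<not> i < r" by auto
    show "r = k"
    proof (rule ccontr)
      assume "r \<noteq> k"
      then have "\<forall>c \<in> column (hat k l D) j. c < r" using r j by (simp add: column_hat)
      then show False
        using i set_le_bound[OF _ _ row_free_le[OF C j(1)]]
          finite_column[OF row_free_diagram[OF C]] finite_column[OF hat_in_diagrams[OF D]] by blast
    qed
  qed
  then show ?thesis using that[OF r(1,2)] \<open>k \<notin> column C j\<close> by (metis less_imp_le nat_less_le)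
qed

text \<open>Makes adding \<open>K\<close> injective and turns the monomial of the union into a
  product of monomials.\<close>

lemma disjoint:
  assumes C: "C \<in> row_free"
  shows "C \<inter> K = {}"
proof -
  have False if "(i, j) \<in> C" "(i, j) \<in> K" for i j
  proof -
    have col: "i \<in> column C j" "i \<in> column K j" using that by (auto simp: column_def)
    have "j < n" using that row_free_diagram[OF C] by (auto simp: diagrams_def)
    consider "j = l" | "j \<noteq> l" "k \<notin> column D j" | "j \<noteq> l" "k \<in> column D j" by blast
    then show False
    proof cases
      case 3
      with col \<open>j < n\<close> show False by (auto elim: column_with_k[OF C])
    qed (use col column_l[OF C] column_without_k \<open>j < n\<close> in auto)
  qed
  then show ?thesis by auto
qed

text \<open>Column l comes from \<open>K\<close> alone. In any other column either \<open>K\<close>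
  is empty, or its row r <= k joins \<open>C\<close> while k returns to the column of
  \<open>hat k l D\<close>.\<close>

lemma union_le:
  assumes C: "C \<in> row_free"
  shows "diagram_le n (C \<union> K) D"
  unfolding diagram_le_def
proof (intro conjI allI impI)
  show "C \<union> K \<in> diagrams n" using row_free_diagram[OF C] K_diagram by (auto simp: diagrams_def)
  fix j assume j: "j < n"
  consider "j = l" | "j \<noteq> l" "k \<notin> column D j" | "j \<noteq> l" "k \<in> column D j" by blast
  then show "set_le (column (C \<union> K) j) (column D j)"
  proof cases
    case 1
    then show ?thesis using column_l[OF C] by (simp add: column_Un)
  next
    case 2
    then show ?thesis using column_without_k[OF j] row_free_le[OF C j]
      by (simp add: column_Un column_hat)
  next
    case 3
    obtain r where r: "column K j = {r}" "r \<le> k" "r \<notin> column C j"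
      "\<forall>i \<in> column C j. i \<le> k \<longrightarrow> i \<le> r"
      by (rule column_with_k[OF C j 3])
    have "set_le (insert r (column C j)) (insert k (column D j - {k}))"
      using r(2,3) row_free_le[OF C j] finite_column[OF row_free_diagram[OF C]] finite_column[OF D] 3
      by (intro set_le_insert) (auto simp: column_hat)
    then show ?thesis using r(1) 3 by (simp add: column_Un insert_absorb)
  qed
qed (rule D)

text \<open>Column l is kept apart because the leading term argument covers only the other columns;
  its minor is the same for every row-free \<open>C\<close>.\<close>

definition off_l :: "diagram \<Rightarrow> (nat \<times> nat, complex) mpoly" where
  "off_l C = (\<Prod>j\<in>{..<n} - {l}. det (submatrix (Ymat n) (column (C \<union> K) j) (column D j)))"

text \<open>Depends on \<open>K\<close> alone, so reading this coefficient is one linear map for all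
  \<open>C\<close>.\<close>

definition top_degree :: nat where
  "top_degree = (\<Sum>j\<in>{..<n} - {l}. \<Sum>(column K j))"

lemma weyl_gen_union:
  assumes "C \<in> row_free"
  shows "weyl_gen n D (C \<union> K) = det (submatrix (Ymat n) (column K l) (column D l)) * off_l C"
  unfolding weyl_gen_def off_l_def using l column_l[OF assms]
  by (subst prod.remove[of _ l]) (auto simp: column_Un)

text \<open>If k is missing from column j of \<open>D\<close>, then \<open>K\<close> is empty there
  and the minor has degree 0 in the new variable. Otherwise the sum is the single row r of
  \<open>K\<close>, and deleting r from the row set returns the column of \<open>C\<close>.\<close>

lemma leading_coeff_column:
  assumes C: "C \<in> row_free" and j: "j < n" "j \<noteq> l"
  shows "\<exists>s \<noteq> 0. degree (grade_column k (det (submatrix (Ymat n) (column (C \<union> K) j) (column D j))))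
      \<le> \<Sum>(column K j) \<and>
    coeff (grade_column k (det (submatrix (Ymat n) (column (C \<union> K) j) (column D j)))) (\<Sum>(column K j)) =
      Const s * det (submatrix (Ymat n) (column C j) (column (hat k l D) j))"
proof (cases "k \<in> column D j")
  case False
  have "Const 1 = (1 :: (nat \<times> nat, complex) mpoly)" by (simp add: Const_def)
  then show ?thesis
    using False column_without_k[OF j False] j column_subset[OF row_free_diagram[OF C]] column_subset[OF D]
    by (intro exI[of _ 1]) (simp add: column_Un column_hat grade_column_det_const)
next
  case True
  obtain r where r: "column K j = {r}" "r \<le> k" "r \<notin> column C j"
    "\<forall>i \<in> column C j. i \<le> k \<longrightarrow> i \<le> r"
    by (rule column_with_k[OF C j True])
  have CK: "C \<union> K \<in> diagrams n" and card: "card (column (C \<union> K) j) = card (column D j)"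
    using union_le[OF C] j by (auto simp: diagram_le_def set_le_def)
  have col: "column (C \<union> K) j = insert r (column C j)" using r by (simp add: column_Un)
  obtain s where "s \<noteq> 0"
    "coeff (grade_column k (det (submatrix (Ymat n) (column (C \<union> K) j) (column D j)))) r =
      Const s * det (submatrix (Ymat n) (column (C \<union> K) j - {r}) (column D j - {k}))"
    "degree (grade_column k (det (submatrix (Ymat n) (column (C \<union> K) j) (column D j)))) \<le> r"
    by (rule grade_column_det_leading[OF column_subset[OF CK] column_subset[OF D] card True, of r])
      (use r in \<open>auto simp: col\<close>)
  then show ?thesis
    using r j by (intro exI[of _ s]) (simp add: col column_hat)
qed

lemma leading_coeff:
  assumes C: "C \<in> row_free"
  shows "\<exists>s \<noteq> 0. coeff (grade_column k (off_l C)) top_degree = Const s * weyl_gen n (hat k l D) C"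
proof -
  interpret g: comm_ring_hom "grade_column k" by (rule comm_ring_hom_grade_column)
  interpret Const: comm_ring_hom "Const :: complex \<Rightarrow> (nat \<times> nat, complex) mpoly"
    by (rule comm_ring_hom_Const)
  let ?J = "{..<n} - {l}"
  let ?f = "\<lambda>j. det (submatrix (Ymat n) (column (C \<union> K) j) (column D j))"
  let ?h = "\<lambda>j. det (submatrix (Ymat n) (column C j) (column (hat k l D) j))"
  have "\<forall>j\<in>?J. \<exists>s. s \<noteq> 0 \<and> degree (grade_column k (?f j)) \<le> \<Sum>(column K j) \<and>
      coeff (grade_column k (?f j)) (\<Sum>(column K j)) = Const s * ?h j"
    using leading_coeff_column[OF C] by auto
  then obtain s where s: "\<And>j. j \<in> ?J \<Longrightarrow> s j \<noteq> 0"
    "\<And>j. j \<in> ?J \<Longrightarrow> degree (grade_column k (?f j)) \<le> \<Sum>(column K j)"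
    "\<And>j. j \<in> ?J \<Longrightarrow> coeff (grade_column k (?f j)) (\<Sum>(column K j)) = Const (s j) * ?h j"
    by (metis (no_types, lifting) bchoice)
  \<comment> \<open>Column l of \<open>hat k l D\<close> is empty, and the determinant of the 0 by 0
    matrix is 1.\<close>
  have "submatrix (Ymat n) {} {} \<in> carrier_mat 0 0" by (simp add: submatrix_def)
  then have "?h l = 1" using column_l[OF C] by (simp add: column_hat)
  then have hat: "weyl_gen n (hat k l D) C = prod ?h ?J"
    using l by (simp add: weyl_gen_def prod.remove[of _ l])
  have "coeff (grade_column k (off_l C)) top_degree = (\<Prod>j\<in>?J. coeff (grade_column k (?f j)) (\<Sum>(column K j)))"
    unfolding off_l_def top_degree_def g.hom_prod by (rule coeff_prod_at_degree_bounds(1)) (rule s(2))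
  also have "\<dots> = (\<Prod>j\<in>?J. Const (s j) * ?h j)" by (rule prod.cong) (simp_all add: s(3))
  also have "\<dots> = Const (prod s ?J) * weyl_gen n (hat k l D) C"
    by (simp add: prod.distrib hat Const.hom_prod)
  finally show ?thesis using s(1) by (intro exI[of _ "prod s ?J"]) auto
qed

text \<open>A relation with coefficients \<open>a C\<close> between the shifted products becomes,
  after cancelling the minor of column l and reading the top coefficient, a relation for
  \<open>hat k l D\<close> with coefficients \<open>a C * s C\<close>. The scalars
  \<open>s C\<close> vary with \<open>C\<close>, through Laplace signs, but are nonzero.\<close>

lemma shifted_independent:
  assumes S: "S \<subseteq> row_free" and inj: "inj_on (weyl_gen n (hat k l D)) S"
    and indep: "mpoly.independent (weyl_gen n (hat k l D) ` S)"
  shows "inj_on (\<lambda>C. weyl_gen n D (C \<union> K)) S"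
    and "mpoly.independent ((\<lambda>C. weyl_gen n D (C \<union> K)) ` S)"
proof -
  interpret g: comm_ring_hom "grade_column k" by (rule comm_ring_hom_grade_column)
  interpret Const: comm_ring_hom "Const :: complex \<Rightarrow> (nat \<times> nat, complex) mpoly"
    by (rule comm_ring_hom_Const)
  have "S \<subseteq> {C. diagram_le n C (hat k l D)}" using S by (auto simp: row_free_def)
  then have fin: "finite S" using finite_diagram_le finite_subset by blast
  obtain s where s: "\<And>C. C \<in> S \<Longrightarrow> s C \<noteq> 0"
    "\<And>C. C \<in> S \<Longrightarrow> coeff (grade_column k (off_l C)) top_degree = Const (s C) * weyl_gen n (hat k l D) C"
    using leading_coeff S by (metis subsetD)
  have "a C = 0" if "(\<Sum>C\<in>S. scale_poly (a C) (weyl_gen n D (C \<union> K))) = 0" "C \<in> S" for a C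
  proof -
    let ?P = "det (submatrix (Ymat n) (column K l) (column D l))"
    have "?P * (\<Sum>C\<in>S. Const (a C) * off_l C) = (\<Sum>C\<in>S. scale_poly (a C) (weyl_gen n D (C \<union> K)))"
      unfolding sum_distrib_left
      using S by (intro sum.cong) (auto simp: weyl_gen_union scale_poly_def mult_ac)
    moreover have "?P \<noteq> 0"
      by (rule det_submatrix_Ymat_nonzero[OF column_subset[OF K_diagram] column_subset[OF D]
        column_l(2)[OF subsetD[OF S that(2)]]])
    \<comment> \<open>The cancellation uses that the polynomials form an integral domain.\<close>
    ultimately have "(\<Sum>C\<in>S. Const (a C) * off_l C) = 0" using that(1) by simp
    then have "0 = coeff (grade_column k (\<Sum>C\<in>S. Const (a C) * off_l C)) top_degree" by simp
    also have "\<dots> = (\<Sum>C\<in>S. Const (a C) * coeff (grade_column k (off_l C)) top_degree)"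
      by (simp add: g.hom_sum g.hom_mult grade_column_Const coeff_sum)
    also have "\<dots> = (\<Sum>C\<in>S. scale_poly (a C * s C) (weyl_gen n (hat k l D) C))"
      by (intro sum.cong) (simp_all add: s(2) scale_poly_def Const.hom_mult mult.assoc)
    finally have "(\<Sum>C\<in>S. scale_poly (a C * s C) (weyl_gen n (hat k l D) C)) = 0" by simp
    then have "a C * s C = 0"
      by (rule inj_on_independent_iff[OF fin, THEN iffD1, OF conjI[OF inj indep], rule_format])
        (rule that(2))
    then show "a C = 0" using s(1) that(2) by simp
  qed
  then show "inj_on (\<lambda>C. weyl_gen n D (C \<union> K)) S"
    and "mpoly.independent ((\<lambda>C. weyl_gen n D (C \<union> K)) ` S)"
    using inj_on_independent_iff[OF fin, of "\<lambda>C. weyl_gen n D (C \<union> K)"] by blast+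
qed

end

text \<open>Basis extension yields a set of vectors. To keep the given diagrams,
  \<open>inv_into\<close> chooses an index only for the vectors that are new.\<close>

lemma extend_independent_family:
  fixes g :: "'c \<Rightarrow> ('v, complex) mpoly"
  assumes "S\<^sub>0 \<subseteq> G" "inj_on g S\<^sub>0" "mpoly.independent (g ` S\<^sub>0)"
  obtains S where "S\<^sub>0 \<subseteq> S" "S \<subseteq> G" "inj_on g S" "mpoly.independent (g ` S)"
    "g ` G \<subseteq> mpoly.span (g ` S)"
proof -
  obtain B where B: "g ` S\<^sub>0 \<subseteq> B" "B \<subseteq> g ` G" "mpoly.independent B" "g ` G \<subseteq> mpoly.span B"
    using mpoly.maximal_independent_subset_extend[of "g ` S\<^sub>0" "g ` G"] assms by blast
  let ?S = "S\<^sub>0 \<union> inv_into G g ` (B - g ` S\<^sub>0)"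
  have inv: "g (inv_into G g b) = b" "inv_into G g b \<in> G" if "b \<in> B" for b
    using that B by (auto simp: f_inv_into_f inv_into_into)
  have img: "g ` ?S = B" using inv B by (force simp: image_Un image_image)
  have "inj_on g (inv_into G g ` (B - g ` S\<^sub>0))"
    by (rule inj_onI) (use inv in auto)
  moreover have "g ` S\<^sub>0 \<inter> g ` inv_into G g ` (B - g ` S\<^sub>0) = {}"
    using inv by auto
  ultimately have "inj_on g ?S"
    using assms(2) by (subst inj_on_Un) blast
  then show ?thesis using that[of ?S] assms inv B img by auto
qed

lemma set_var_zero_diagram_monom:
  assumes "finite C"
  shows "set_var_zero k (diagram_monom C) = (if \<exists>j. (k, j) \<in> C then 0 else diagram_monom C)"
proof -
  interpret z: comm_ring_hom "set_var_zero k"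
    unfolding set_var_zero_def by (rule comm_ring_hom_subst_poly)
  have "set_var_zero k (diagram_monom C) = (\<Prod>(i, j)\<in>C. if i = k then 0 else Var i)"
    unfolding diagram_monom_def z.hom_prod by (simp add: case_prod_unfold set_var_zero_def)
  also have "\<dots> = (if \<exists>j. (k, j) \<in> C then 0 else diagram_monom C)"
    using assms by (auto simp: diagram_monom_def intro!: prod_zero prod.cong bexI)
  finally show ?thesis .
qed

theorem theorem4p1:
  fixes n k l :: nat and D :: diagram and M :: "(nat, complex) mpoly"
  assumes "D \<in> diagrams n" and "k < n" and "l < n"
    and "\<exists>K \<in> Purple n k l D. M = (\<Prod>(i, j)\<in>K. Var i)"
  shows "dual_character n D - M * set_var_zero k (dual_character n (hat k l D))
    \<in> nonneg_int_polys n"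
proof -
  obtain K where K: "K \<in> Purple n k l D" and M: "M = diagram_monom K"
    using assms(4) by (auto simp: diagram_monom_def)
  interpret purple_shift n k l D K using assms K by unfold_locales
  interpret z: comm_ring_hom "set_var_zero k"
    unfolding set_var_zero_def by (rule comm_ring_hom_subst_poly)
  obtain T where T: "T \<subseteq> {C. diagram_le n C (hat k l D)}" "inj_on (weyl_gen n (hat k l D)) T"
    "mpoly.independent (weyl_gen n (hat k l D) ` T)"
    "weyl_gen n (hat k l D) ` {C. diagram_le n C (hat k l D)} \<subseteq>
      mpoly.span (weyl_gen n (hat k l D) ` T)"
    using extend_independent_family[of "{}" "{C. diagram_le n C (hat k l D)}" "weyl_gen n (hat k l D)"]
    by (auto simp: mpoly.independent_empty)
  have finT: "finite T" using T(1) finite_diagram_le finite_subset by blast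
  let ?R = "T \<inter> row_free"
  have "inj_on (weyl_gen n (hat k l D)) ?R" using T(2) by (rule inj_on_subset) auto
  moreover have "mpoly.independent (weyl_gen n (hat k l D) ` ?R)"
    using T(3) by (rule mpoly.independent_mono) auto
  ultimately have shifted: "inj_on (\<lambda>C. weyl_gen n D (C \<union> K)) ?R"
    "mpoly.independent ((\<lambda>C. weyl_gen n D (C \<union> K)) ` ?R)"
    using shifted_independent[of ?R] by auto
  have "inj_on (\<lambda>C. C \<union> K) ?R"
    using disjoint by (intro inj_onI) blast
  then have monoms: "(\<Sum>C\<in>(\<lambda>C. C \<union> K) ` ?R. diagram_monom C) =
      M * set_var_zero k (dual_character n (hat k l D))"
  proof -
    assume "inj_on (\<lambda>C. C \<union> K) ?R"
    then have "(\<Sum>C\<in>(\<lambda>C. C \<union> K) ` ?R. diagram_monom C) = (\<Sum>C\<in>?R. diagram_monom (C \<union> K))"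
      by (simp add: sum.reindex)
    also have "\<dots> = (\<Sum>C\<in>?R. M * diagram_monom C)"
      using disjoint finite_diagram[OF K_diagram] finite_diagram[OF row_free_diagram]
      by (intro sum.cong) (auto simp: M diagram_monom_def prod.union_disjoint mult.commute)
    \<comment> \<open>Members of \<open>T\<close> with a box in row k are sent to 0 by
      \<open>set_var_zero k\<close>, so the sum extends from \<open>?R\<close> to
      \<open>T\<close>.\<close>
    also have "\<dots> = M * (\<Sum>C\<in>T. set_var_zero k (diagram_monom C))"
    proof -
      have "finite C" if "C \<in> T" for C
        using that T(1) by (auto simp: diagram_le_def intro: finite_diagram)
      then show ?thesis
        unfolding sum_distrib_left using T(1) finT
        by (intro sum.mono_neutral_cong_left)
          (auto simp: row_free_def set_var_zero_diagram_monom)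
    qed
    finally show ?thesis by (simp add: dual_character_eq[OF T] z.hom_sum)
  qed
  obtain S where S: "(\<lambda>C. C \<union> K) ` ?R \<subseteq> S" "S \<subseteq> {C. diagram_le n C D}" "inj_on (weyl_gen n D) S"
    "mpoly.independent (weyl_gen n D ` S)"
    "weyl_gen n D ` {C. diagram_le n C D} \<subseteq> mpoly.span (weyl_gen n D ` S)"
  proof (rule extend_independent_family)
    show "(\<lambda>C. C \<union> K) ` ?R \<subseteq> {C. diagram_le n C D}" using union_le by auto
    show "inj_on (weyl_gen n D) ((\<lambda>C. C \<union> K) ` ?R)"
      using shifted(1) by (auto intro: inj_on_imageI simp: comp_def)
    show "mpoly.independent (weyl_gen n D ` (\<lambda>C. C \<union> K) ` ?R)"
      using shifted(2) by (simp add: image_image)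
  qed
  have "finite S" using S(2) finite_diagram_le finite_subset by blast
  then have "dual_character n D - M * set_var_zero k (dual_character n (hat k l D)) =
      (\<Sum>C\<in>S - (\<lambda>C. C \<union> K) ` ?R. diagram_monom C)"
    using S(1) by (simp add: dual_character_eq[OF S(2-5)] sum_diff flip: monoms)
  also have "\<dots> \<in> nonneg_int_polys n"
    using S(2) by (intro nonneg_int_polys_sum diagram_monom_nonneg) (auto simp: diagram_le_def)
  finally show ?thesis .
qed

end
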